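(* Let $(A,\mu,\alpha)$ be a Hom-algebra over $\mathbf{k}$. Then $A$ is a Hom-associative algebra if and only if it is both a Hom-alternative algebra and a Hom-Lie-admissible algebra.
   Context: $\mathbf{k}$ is a fixed field of characteristic $0$; all modules, linear maps and tensor products are over $\mathbf{k}$. A Hom-algebra is a triple $(A,\mu,\alpha)$ with $A$ a $\mathbf{k}$-module, $\mu\colon A\otimes A\to A$ bilinear (not necessarily associative or unital), and $\alpha\colon A\to A$ linear with $\alpha(\mu(x,y))=\mu(\alpha(x),\alpha(y))$ for all $x,y$. The Hom-associator is $as_A(x,y,z)=\mu(\mu(x,y),\alpha(z))-\mu(\alpha(x),\mu(y,z))$. $A$ is Hom-associative if $as_A=0$, and Hom-alternative if $as_A$ is alternating (changes by the sign of the permutation when its arguments are permuted). A Hom-Lie algebra is a Hom-algebra $(B,[-,-],\alpha)$ with $[-,-]$ anti-symmetric and $[[x,y],\alpha(z)]+[[z,x],\alpha(y)]+[[y,z],\alpha(x)]=0$ for all $x,y,z\in B$. $A$ is Hom-Lie-admissible if its commutator Hom-algebra $A^-=(A,[-,-],\alpha)$, with $[x,y]=\mu(x,y)-\mu(y,x)$, is a Hom-Lie algebra. *)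

theory Defs
  imports Complex_Main "HOL-Combinatorics.Permutations"
begin

locale hom_algebra = vector_space scale
  for scale :: "'k::field_char_0 \<Rightarrow> 'a::ab_group_add \<Rightarrow> 'a" +
  fixes \<mu> :: "'a \<Rightarrow> 'a \<Rightarrow> 'a"
    and \<alpha> :: "'a \<Rightarrow> 'a"
  assumes linear_mult_left: "\<And>y. Vector_Spaces.linear scale scale (\<lambda>x. \<mu> x y)"
    and linear_mult_right: "\<And>x. Vector_Spaces.linear scale scale (\<lambda>y. \<mu> x y)"
    and linear_twist: "Vector_Spaces.linear scale scale \<alpha>"
    and twist_mult: "\<And>x y. \<alpha> (\<mu> x y) = \<mu> (\<alpha> x) (\<alpha> y)"

definition hom_associator ::
    "('a::ab_group_add \<Rightarrow> 'a \<Rightarrow> 'a) \<Rightarrow> ('a \<Rightarrow> 'a) \<Rightarrow> 'a \<Rightarrow> 'a \<Rightarrow> 'a \<Rightarrow> 'a" where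
  "hom_associator \<mu> \<alpha> x y z = \<mu> (\<mu> x y) (\<alpha> z) - \<mu> (\<alpha> x) (\<mu> y z)"

definition commutator :: "('a::ab_group_add \<Rightarrow> 'a \<Rightarrow> 'a) \<Rightarrow> 'a \<Rightarrow> 'a \<Rightarrow> 'a" where
  "commutator \<mu> x y = \<mu> x y - \<mu> y x"

text \<open>The three arguments are the values \<open>v 0\<close>, \<open>v 1\<close>, \<open>v 2\<close>, so that permuting them
  is composing \<open>v\<close> with a permutation of \<open>{..<3}\<close>.\<close>

definition alternating3 ::
    "('k::field_char_0 \<Rightarrow> 'b::ab_group_add \<Rightarrow> 'b) \<Rightarrow> ('a \<Rightarrow> 'a \<Rightarrow> 'a \<Rightarrow> 'b) \<Rightarrow> bool" where
  "alternating3 scale f \<longleftrightarrow>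
     (\<forall>p (v :: nat \<Rightarrow> 'a). p permutes {..<3} \<longrightarrow>
        f (v (p 0)) (v (p 1)) (v (p 2)) = scale (of_int (sign p)) (f (v 0) (v 1) (v 2)))"

locale hom_associative_algebra = hom_algebra +
  assumes hom_associator_eq_0: "\<And>x y z. hom_associator \<mu> \<alpha> x y z = 0"

locale hom_alternative_algebra = hom_algebra +
  assumes alternating_hom_associator: "alternating3 scale (hom_associator \<mu> \<alpha>)"

locale hom_lie_algebra = hom_algebra scale bracket \<alpha>
  for scale :: "'k::field_char_0 \<Rightarrow> 'a::ab_group_add \<Rightarrow> 'a" and bracket \<alpha> +
  assumes bracket_antisym: "\<And>x y. bracket x y = - bracket y x"
    and hom_jacobi: "\<And>x y z. bracket (bracket x y) (\<alpha> z) + bracket (bracket z x) (\<alpha> y)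
                        + bracket (bracket y z) (\<alpha> x) = 0"

locale hom_lie_admissible_algebra = hom_algebra +
  assumes hom_lie_commutator: "hom_lie_algebra scale (commutator \<mu>) \<alpha>"

end

theory Submission
  imports Defs
begin

text \<open>
  Expanding the left-hand side of the Hom-Jacobi identity for the commutator bracket produces twelve
  products, which pair up into the six Hom-associators of permutations of \<open>x\<close>, \<open>y\<close>, \<open>z\<close>: the sum is
  the antisymmetrization \<open>\<Sum>\<sigma>. sign \<sigma> \<cdot> as (\<sigma> (x, y, z))\<close>
  (\<open>cyclic_commutator_eq_associators\<close>). Hence \<open>A\<close> is Hom-Lie-admissible exactly when the
  Hom-associator has vanishing antisymmetrization. A Hom-associator that is zero is alternating and
  has zero antisymmetrization. Conversely, the antisymmetrization of an alternating map is six times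
  the map, and \<open>6\<close> is invertible in characteristic \<open>0\<close>, so being both alternating and
  Hom-Lie-admissible forces the Hom-associator to vanish.
\<close>

context hom_algebra
begin

sublocale endo: vector_space_pair scale scale
  by unfold_locales

lemma mult_diff_left: "\<mu> (x - y) z = \<mu> x z - \<mu> y z"
  using endo.linear_diff[OF linear_mult_left] .

lemma mult_diff_right: "\<mu> x (y - z) = \<mu> x y - \<mu> x z"
  using endo.linear_diff[OF linear_mult_right] .

lemma twist_diff: "\<alpha> (x - y) = \<alpha> x - \<alpha> y"
  using endo.linear_diff[OF linear_twist] .

lemma hom_algebra_commutator: "hom_algebra scale (commutator \<mu>) \<alpha>"
proof (intro hom_algebra.intro hom_algebra_axioms.intro vector_space_axioms)
  show "Vector_Spaces.linear scale scale (\<lambda>x. commutator \<mu> x y)" for y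
    unfolding commutator_def
    by (intro endo.linear_compose_sub linear_mult_left linear_mult_right)
  show "Vector_Spaces.linear scale scale (\<lambda>y. commutator \<mu> x y)" for x
    unfolding commutator_def
    by (intro endo.linear_compose_sub linear_mult_left linear_mult_right)
  show "Vector_Spaces.linear scale scale \<alpha>"
    by (fact linear_twist)
  show "\<alpha> (commutator \<mu> x y) = commutator \<mu> (\<alpha> x) (\<alpha> y)" for x y
    by (simp add: commutator_def twist_diff twist_mult)
qed

text \<open>
  Expand by bilinearity: each \<open>\<mu> (\<mu> a b) (\<alpha> c)\<close> comes from the outer bracket in its given
  order and each \<open>\<mu> (\<alpha> a) (\<mu> b c)\<close> from the reversed order, once for every permutation and with its
  sign.
\<close>

lemma cyclic_commutator_eq_associators:
  "commutator \<mu> (commutator \<mu> x y) (\<alpha> z) + commutator \<mu> (commutator \<mu> z x) (\<alpha> y)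
     + commutator \<mu> (commutator \<mu> y z) (\<alpha> x) =
   hom_associator \<mu> \<alpha> x y z + hom_associator \<mu> \<alpha> y z x + hom_associator \<mu> \<alpha> z x y
     - hom_associator \<mu> \<alpha> y x z - hom_associator \<mu> \<alpha> x z y - hom_associator \<mu> \<alpha> z y x"
  by (simp add: commutator_def hom_associator_def mult_diff_left mult_diff_right algebra_simps)

lemma hom_lie_admissible_iff_associators:
  "hom_lie_admissible_algebra scale \<mu> \<alpha> \<longleftrightarrow>
     (\<forall>x y z. hom_associator \<mu> \<alpha> x y z + hom_associator \<mu> \<alpha> y z x + hom_associator \<mu> \<alpha> z x y
        - hom_associator \<mu> \<alpha> y x z - hom_associator \<mu> \<alpha> x z y - hom_associator \<mu> \<alpha> z y x = 0)"
proof -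
  have antisym: "commutator \<mu> x y = - commutator \<mu> y x" for x y
    by (simp add: commutator_def)
  show ?thesis
    unfolding hom_lie_admissible_algebra_def hom_lie_admissible_algebra_axioms_def
      hom_lie_algebra_def hom_lie_algebra_axioms_def cyclic_commutator_eq_associators
    using hom_algebra_axioms hom_algebra_commutator antisym by blast
qed

end

text \<open>
  The two adjacent transpositions generate the symmetric group on three letters, so these two sign
  rules determine the value at every rearrangement of the arguments.
\<close>

lemma alternating3_swap:
  assumes "vector_space scale" "alternating3 scale f"
  shows alternating3_swap_left: "f y x z = - f x y z"
    and alternating3_swap_right: "f x z y = - f x y z"
proof -
  interpret vector_space scale by fact
  let ?v = "\<lambda>i::nat. if i = 0 then x else if i = 1 then y else z"
  have alt: "f (?v (p 0)) (?v (p 1)) (?v (p 2)) = scale (of_int (sign p)) (f x y z)"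
    if "p permutes {..<3}" for p
    using assms(2)[unfolded alternating3_def, rule_format, OF that, of ?v] by simp
  have "transpose 0 1 permutes {..<3::nat}" "transpose 1 2 permutes {..<3::nat}"
    by (auto intro: permutes_swap_id)
  from this[THEN alt] show "f y x z = - f x y z" "f x z y = - f x y z"
    by (simp_all add: sign_swap_id transpose_def)
qed

text \<open>
  Each rearranged term, taken with the sign of its permutation, equals \<open>f x y z\<close>.
\<close>

lemma alternating3_antisymmetrization:
  assumes "vector_space scale" "alternating3 scale f"
  shows "f x y z + f y z x + f z x y - f y x z - f x z y - f z y x = scale 6 (f x y z)"
proof -
  interpret vector_space scale by fact
  note swap_left = alternating3_swap_left[OF assms]
  note swap_right = alternating3_swap_right[OF assms]
  have "f y x z = - f x y z"
    by (rule swap_left)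
  moreover have "f x z y = - f x y z"
    by (rule swap_right)
  moreover have "f y z x = f x y z"
    using swap_right[of y z x] swap_left[of y x z] by simp
  moreover have "f z x y = f x y z"
    using swap_left[of z x y] swap_right[of x z y] by simp
  moreover have "f z y x = - f x y z"
    using swap_left[of z y x] \<open>f y z x = f x y z\<close> by simp
  \<comment> \<open>one summand for each permutation of the arguments\<close>
  moreover have "scale 6 (f x y z) =
      scale (1 + 1 + 1 + 1 + 1 + 1) (f x y z)"
    by simp
  ultimately show ?thesis
    by (simp only: scale_left_distrib scale_one) simp
qed

theorem proposition6p1:
  fixes scale :: "'k::field_char_0 \<Rightarrow> 'a::ab_group_add \<Rightarrow> 'a"
    and \<mu> :: "'a \<Rightarrow> 'a \<Rightarrow> 'a"
    and \<alpha> :: "'a \<Rightarrow> 'a"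
  assumes "hom_algebra scale \<mu> \<alpha>"
  shows "hom_associative_algebra scale \<mu> \<alpha> \<longleftrightarrow>
           hom_alternative_algebra scale \<mu> \<alpha> \<and> hom_lie_admissible_algebra scale \<mu> \<alpha>"
proof -
  interpret hom_algebra scale \<mu> \<alpha> by fact
  show ?thesis
  proof (intro iffI conjI)
    assume "hom_associative_algebra scale \<mu> \<alpha>"
    then have zero: "hom_associator \<mu> \<alpha> x y z = 0" for x y z
      by (rule hom_associative_algebra.hom_associator_eq_0)
    show "hom_alternative_algebra scale \<mu> \<alpha>"
      by unfold_locales (simp add: alternating3_def zero)
    show "hom_lie_admissible_algebra scale \<mu> \<alpha>"
      by (simp add: hom_lie_admissible_iff_associators zero)
  next
    assume "hom_alternative_algebra scale \<mu> \<alpha> \<and> hom_lie_admissible_algebra scale \<mu> \<alpha>"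
    then have alt: "alternating3 scale (hom_associator \<mu> \<alpha>)"
      and lie: "hom_lie_admissible_algebra scale \<mu> \<alpha>"
      by (auto dest: hom_alternative_algebra.alternating_hom_associator)
    have "scale 6 (hom_associator \<mu> \<alpha> x y z) = 0" for x y z
      using lie alternating3_antisymmetrization[OF vector_space_axioms alt, of x y z]
      by (simp add: hom_lie_admissible_iff_associators)
    then show "hom_associative_algebra scale \<mu> \<alpha>"
      by unfold_locales simp
  qed
qed

end
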